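(* Let $G$ be a connected graph. Then the connected blocks polytope $\mathrm{CBP}(G)$ is Gorenstein of index $2$.
   Context: Graphs are finite, simple and undirected. A connected graph is 2-connected if it has at least three vertices and remains connected after deleting any single vertex. A bridge is an edge whose deletion increases the number of connected components. A block of $G$ is a maximal 2-connected subgraph of $G$ or a bridge together with its two end vertices; $\mathcal{B}$ denotes the set of blocks of $G$. For $\mathcal{A}\subseteq\mathcal{B}$ let $G[\mathcal{A}]=\bigcup_{B\in\mathcal{A}}B$ (the empty graph counts as connected), and let $\chi^{\mathcal{A}}\in\{0,1\}^{\mathcal{B}}$ be the incidence vector of $\mathcal{A}$. The connected blocks polytope is $\mathrm{CBP}(G)=\mathrm{conv}\{\chi^{\mathcal{A}}\mid \mathcal{A}\subseteq\mathcal{B},\ G[\mathcal{A}]\text{ connected}\}\subseteq\mathbb{R}^{\mathcal{B}}$; it is full-dimensional. A full-dimensional lattice polytope $P\subseteq\mathbb{R}^d$ with the origin in its interior is reflexive if its dual polytope $P^{\Delta}=\{y\in\mathbb{R}^d\mid \langle y,x\rangle\le1\ \forall x\in P\}$ is also a lattice polytope. A full-dimensional lattice polytope $P$ is Gorenstein of index $k$ if the dilation $kP$ is reflexive up to translation by a lattice vector, i.e. there is $w\in\mathbb{Z}^d$ such that $kP-w$ is reflexive. *)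

theory Defs
  imports "HOL-Analysis.Analysis"
begin

section \<open>Finite simple graphs and their blocks\<close>

text \<open>
  A graph is a pair of a vertex set and a set of edges, each edge being the two-element set of
  its end vertices.  With this plain encoding, \<open>'v graph\<close> is of class \<open>finite\<close> whenever \<open>'v\<close> is.
\<close>

type_synonym 'v graph = "'v set \<times> 'v set set"

abbreviation verts :: "'v graph \<Rightarrow> 'v set" where "verts \<equiv> fst"
abbreviation edges :: "'v graph \<Rightarrow> 'v set set" where "edges \<equiv> snd"

definition simple_graph :: "'v graph \<Rightarrow> bool" where
  "simple_graph G \<longleftrightarrow> finite (verts G) \<and> (\<forall>e\<in>edges G. e \<subseteq> verts G \<and> card e = 2)"

definition subgraph :: "'v graph \<Rightarrow> 'v graph \<Rightarrow> bool" where
  "subgraph H G \<longleftrightarrow> simple_graph H \<and> verts H \<subseteq> verts G \<and> edges H \<subseteq> edges G"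

definition reach :: "'v graph \<Rightarrow> ('v \<times> 'v) set" where
  "reach G = {(u, v). u \<in> verts G \<and> v \<in> verts G \<and> (u, v) \<in> {(x, y). {x, y} \<in> edges G}\<^sup>*}"

text \<open>The graph without vertices is connected under this definition.\<close>

definition connected_graph :: "'v graph \<Rightarrow> bool" where
  "connected_graph G \<longleftrightarrow> (\<forall>u\<in>verts G. \<forall>v\<in>verts G. (u, v) \<in> reach G)"

definition num_components :: "'v graph \<Rightarrow> nat" where
  "num_components G = card (verts G // reach G)"

definition delete_vertex :: "'v graph \<Rightarrow> 'v \<Rightarrow> 'v graph" where
  "delete_vertex G v = (verts G - {v}, {e \<in> edges G. v \<notin> e})"

definition delete_edge :: "'v graph \<Rightarrow> 'v set \<Rightarrow> 'v graph" where
  "delete_edge G e = (verts G, edges G - {e})"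

definition two_connected :: "'v graph \<Rightarrow> bool" where
  "two_connected G \<longleftrightarrow> connected_graph G \<and> card (verts G) \<ge> 3 \<and>
     (\<forall>v\<in>verts G. connected_graph (delete_vertex G v))"

definition bridge :: "'v graph \<Rightarrow> 'v set \<Rightarrow> bool" where
  "bridge G e \<longleftrightarrow> e \<in> edges G \<and> num_components (delete_edge G e) > num_components G"

text \<open>An edge \<open>e\<close> together with its two end vertices is the graph \<open>(e, {e})\<close>.\<close>

definition blocks :: "'v graph \<Rightarrow> 'v graph set" where
  "blocks G =
     {B. subgraph B G \<and> two_connected B \<and>
         (\<forall>H. subgraph H G \<and> two_connected H \<and> subgraph B H \<longrightarrow> H = B)}
     \<union> {(e, {e}) | e. bridge G e}"

definition graph_Union :: "'v graph set \<Rightarrow> 'v graph" where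
  "graph_Union \<A> = (\<Union>B\<in>\<A>. verts B, \<Union>B\<in>\<A>. edges B)"


section \<open>Lattice polytopes in a coordinate space\<close>

text \<open>
  For a set \<open>I\<close> of coordinates, \<open>\<real>\<^sup>I\<close> is represented by the vectors of \<open>real ^ 'n\<close> that vanish
  outside \<open>I\<close>, so that the dimension \<open>card I\<close> may depend on a term and may be \<open>0\<close>.  All notions
  below (lattice, full-dimensionality, interior, dual) are the usual ones of \<open>\<real>\<^sup>I\<close>.
\<close>

definition coord_space :: "'n set \<Rightarrow> (real ^ 'n) set" where
  "coord_space I = {x. \<forall>i. i \<notin> I \<longrightarrow> x $ i = 0}"

definition int_lattice :: "'n set \<Rightarrow> (real ^ 'n) set" where
  "int_lattice I = {x \<in> coord_space I. \<forall>i. x $ i \<in> \<int>}"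

definition lattice_polytope :: "'n::finite set \<Rightarrow> (real ^ 'n) set \<Rightarrow> bool" where
  "lattice_polytope I P \<longleftrightarrow> (\<exists>V. finite V \<and> V \<subseteq> int_lattice I \<and> P = convex hull V)"

definition full_dimensional :: "'n::finite set \<Rightarrow> (real ^ 'n) set \<Rightarrow> bool" where
  "full_dimensional I P \<longleftrightarrow> affine hull P = coord_space I"

definition dual_polytope :: "'n::finite set \<Rightarrow> (real ^ 'n) set \<Rightarrow> (real ^ 'n) set" where
  "dual_polytope I P = {y \<in> coord_space I. \<forall>x\<in>P. y \<bullet> x \<le> 1}"

definition reflexive :: "'n::finite set \<Rightarrow> (real ^ 'n) set \<Rightarrow> bool" where
  "reflexive I P \<longleftrightarrow> lattice_polytope I P \<and> full_dimensional I P \<and>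
     0 \<in> top_of_set (coord_space I) interior_of P \<and> lattice_polytope I (dual_polytope I P)"

definition gorenstein :: "'n::finite set \<Rightarrow> nat \<Rightarrow> (real ^ 'n) set \<Rightarrow> bool" where
  "gorenstein I k P \<longleftrightarrow> lattice_polytope I P \<and> full_dimensional I P \<and>
     (\<exists>w\<in>int_lattice I. reflexive I ((\<lambda>x. real k *\<^sub>R x - w) ` P))"


section \<open>The connected blocks polytope\<close>

definition incidence_vector :: "'n::finite set \<Rightarrow> real ^ 'n" where
  "incidence_vector A = (\<chi> i. if i \<in> A then 1 else 0)"

text \<open>A subset of \<open>coord_space (blocks G)\<close>, which plays the role of the space indexed by the blocks.\<close>

definition CBP :: "'v::finite graph \<Rightarrow> (real ^ 'v graph) set" where
  "CBP G = convex hull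
     {incidence_vector \<A> | \<A>. \<A> \<subseteq> blocks G \<and> connected_graph (graph_Union \<A>)}"

end

theory Submission
  imports Defs
begin

text \<open>
  Write \<open>g(\<A>) = |V(\<A>)| - \<Sum>\<^sub>B (|V(B)| - 1)\<close>, with \<open>B\<close> ranging over \<open>\<A>\<close>.  A connected union
  of blocks meets any further block in at most one vertex, so adding blocks one at a time shows
  \<open>g(\<A>) = 1\<close> for every nonempty connected \<open>\<A>\<close>; in general \<open>g\<close> counts the connected components.
  Splitting a nonnegative vector along its level sets, and each level set into its components, one
  finds that CBP is cut out by \<open>x \<ge> 0\<close> and the inequalities
  \<open>\<Sum>\<^sub>B (1 - |V(B)| + |{v. \<phi>(v) = B}|) x\<^sub>B \<le> 1\<close>, where \<open>\<phi>\<close> assigns to every vertex a block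
  containing it.  The coefficient sum of each of these is \<open>g(\<B>) = 1\<close>.  Hence, if \<open>w\<close> denotes the
  all-ones vector, \<open>2 CBP - w\<close> is cut out by inequalities \<open>a \<bullet> y \<le> 1\<close> with integral \<open>a\<close>, and its
  dual is the convex hull of these vectors \<open>a\<close> and the origin.
\<close>

section \<open>Polytopes of hyperforests\<close>

lemma subspace_coord_space: "subspace (coord_space I)"
  by (auto simp: coord_space_def subspace_def)

lemma incidence_vector_int_lattice: "A \<subseteq> I \<Longrightarrow> incidence_vector A \<in> int_lattice I"
  by (auto simp: incidence_vector_def int_lattice_def coord_space_def)

lemma inner_incidence_vector: "a \<bullet> incidence_vector A = (\<Sum>i\<in>A. a $ i)"
proof -
  have "a \<bullet> incidence_vector A = (\<Sum>i\<in>UNIV. if i \<in> A then a $ i else 0)"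
    unfolding inner_vec_def incidence_vector_def by (intro sum.cong) auto
  then show ?thesis by (simp add: sum.If_cases)
qed

lemma inner_coord_space:
  fixes a x :: "real ^ 'n"
  assumes "x \<in> coord_space I"
  shows "a \<bullet> x = (\<Sum>i\<in>I. a $ i * x $ i)"
  unfolding inner_vec_def inner_real_def
  using assms by (intro sum.mono_neutral_right) (auto simp: coord_space_def)

text \<open>This is the bipolar theorem: the hull is closed because \<open>V\<close> is finite, so a
  point outside it is cut off by a hyperplane, which after rescaling becomes a point of the primal
  set. The origin joins \<open>V\<close> because it always satisfies the dual condition.\<close>

lemma dual_polytope_inequalities:
  fixes V :: "(real ^ 'n) set"
  assumes "finite V" and V: "V \<subseteq> coord_space I"
  shows "dual_polytope I {x \<in> coord_space I. \<forall>a\<in>V. a \<bullet> x \<le> 1} = convex hull (insert 0 V)"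
    (is "dual_polytope I ?D = ?K")
proof (intro equalityI subsetI)
  have K: "?K \<subseteq> coord_space I"
    using V subspace_coord_space[of I]
    by (intro hull_minimal) (auto simp: subspace_0 subspace_imp_convex)
  show "y \<in> dual_polytope I ?D" if "y \<in> ?K" for y
  proof -
    have "?K \<subseteq> {y. \<forall>x\<in>?D. y \<bullet> x \<le> 1}"
    proof (intro hull_minimal)
      have "{y. \<forall>x\<in>?D. y \<bullet> x \<le> 1} = (\<Inter>x\<in>?D. {y. x \<bullet> y \<le> 1})"
        by (auto simp: inner_commute)
      then show "convex {y. \<forall>x\<in>?D. y \<bullet> x \<le> 1}"
        by (simp add: convex_INT convex_halfspace_le)
    qed auto
    then show ?thesis using K that by (auto simp: dual_polytope_def)
  qed
  show "y \<in> ?K" if y: "y \<in> dual_polytope I ?D" for y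
  proof (rule ccontr)
    assume "y \<notin> ?K"
    moreover have "closed ?K"
      using \<open>finite V\<close> by (simp add: compact_imp_closed finite_imp_compact_convex_hull)
    ultimately obtain z b where zb: "z \<bullet> y < b" "\<forall>x\<in>?K. z \<bullet> x > b"
      using separating_hyperplane_closed_point[of ?K y] by auto
    have "0 \<in> ?K" by (simp add: hull_inc)
    with zb(2) have "b < 0" by fastforce
    \<comment> \<open>Division by the negative \<open>b\<close> turns the lower bound
      \<open>b\<close> into an upper bound 1. Coordinates outside \<open>I\<close> are cleared
      because \<open>z\<close> comes from the whole space.\<close>
    define x where "x = (\<chi> i. if i \<in> I then z $ i / b else 0)"
    have x: "c \<bullet> x = (z \<bullet> c) / b" if "c \<in> coord_space I" for c
      unfolding inner_coord_space[OF that, of z] inner_commute[of c x] inner_coord_space[OF that, of x]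
      by (simp add: x_def sum_divide_distrib)
    have "a \<bullet> x \<le> 1" if "a \<in> V" for a
    proof -
      have "z \<bullet> a > b" using zb(2) that by (simp add: hull_inc)
      then have "(z \<bullet> a) / b \<le> 1" using \<open>b < 0\<close> by (simp add: neg_divide_le_eq)
      then show ?thesis using x[of a] that V by auto
    qed
    then have "x \<in> ?D" by (auto simp: x_def coord_space_def)
    with y have "y \<bullet> x \<le> 1" by (auto simp: dual_polytope_def)
    moreover have "y \<bullet> x = (z \<bullet> y) / b" using y x by (auto simp: dual_polytope_def)
    ultimately show False using zb(1) \<open>b < 0\<close> by (auto simp: field_simps)
  qed
qed

text \<open>Every inequality is strict at the origin, and finitely many open half-spaces intersect
  in an open set.\<close>

lemma zero_interior_inequalities:
  fixes V :: "(real ^ 'n) set"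
  assumes "finite V"
  shows "0 \<in> top_of_set (coord_space I) interior_of {x \<in> coord_space I. \<forall>a\<in>V. a \<bullet> x \<le> 1}"
proof -
  let ?T = "\<Inter>a\<in>V. {x. a \<bullet> x < 1}"
  have "open ?T" using assms by (intro open_INT) (auto simp: open_halfspace_lt)
  then have "openin (top_of_set (coord_space I)) (coord_space I \<inter> ?T)" by blast
  moreover have "0 \<in> coord_space I \<inter> ?T" by (auto simp: coord_space_def)
  moreover have "coord_space I \<inter> ?T \<subseteq> {x \<in> coord_space I. \<forall>a\<in>V. a \<bullet> x \<le> 1}"
    by (auto intro: less_imp_le)
  ultimately show ?thesis unfolding interior_of_def by blast
qed

lemma full_dimensional_affinity:
  fixes P :: "(real ^ 'n) set"
  assumes "full_dimensional I P" "w \<in> coord_space I" "c \<noteq> 0"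
  shows "full_dimensional I ((\<lambda>x. c *\<^sub>R x - w) ` P)"
proof -
  have eq: "(\<lambda>x. c *\<^sub>R x - w) ` S = (+) (- w) ` ((*\<^sub>R) c ` S)" for S
    by (auto simp: image_image)
  have "affine hull ((\<lambda>x. c *\<^sub>R x - w) ` P) = (\<lambda>x. c *\<^sub>R x - w) ` coord_space I"
    using assms(1) unfolding eq affine_hull_translation full_dimensional_def
    by (simp add: affine_hull_linear_image[symmetric] bounded_linear_scaleR_right)
  also have "\<dots> = coord_space I"
  proof (intro equalityI subsetI)
    fix y assume y: "y \<in> coord_space I"
    have "y = c *\<^sub>R ((1 / c) *\<^sub>R (y + w)) - w" using \<open>c \<noteq> 0\<close> by simp
    moreover have "(1 / c) *\<^sub>R (y + w) \<in> coord_space I"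
      using y assms(2) by (auto simp: coord_space_def)
    ultimately show "y \<in> (\<lambda>x. c *\<^sub>R x - w) ` coord_space I" by blast
  qed (use assms(2) in \<open>auto simp: coord_space_def\<close>)
  finally show ?thesis by (simp add: full_dimensional_def)
qed

section \<open>Hyperforests and their candidate facet normals\<close>

text \<open>An abstraction of the block structure: \<open>I\<close> stands for the blocks,
  \<open>vs\<close> for their vertex sets and \<open>C\<close> for the connected families.
  \<open>C_euler\<close> expresses that a nonempty connected family is a hypertree, and
  \<open>C_component\<close> splits off a connected part that shares no vertex with the
  rest.\<close>

locale hyperforest =
  fixes I :: "'n::finite set" and vs :: "'n \<Rightarrow> 'v::finite set" and C :: "'n set set"
  assumes C_sub: "A \<in> C \<Longrightarrow> A \<subseteq> I"
    and C_empty: "{} \<in> C"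
    and C_single: "i \<in> I \<Longrightarrow> {i} \<in> C"
    and C_top: "I \<in> C"
    and C_euler: "\<lbrakk>A \<in> C; A \<noteq> {}\<rbrakk> \<Longrightarrow> real (card (\<Union>(vs ` A))) + (\<Sum>i\<in>A. 1 - real (card (vs i))) = 1"
    and C_component: "\<lbrakk>A \<subseteq> I; A \<noteq> {}\<rbrakk> \<Longrightarrow>
      \<exists>S\<in>C. S \<noteq> {} \<and> S \<subseteq> A \<and> \<Union>(vs ` S) \<inter> \<Union>(vs ` (A - S)) = {}"
begin

text \<open>The function \<open>g\<close> of the introduction; it vanishes on the empty
  family.\<close>

definition euler :: "'n set \<Rightarrow> real" where
  "euler A = real (card (\<Union>(vs ` A))) + (\<Sum>i\<in>A. 1 - real (card (vs i)))"

definition P :: "(real ^ 'n) set" where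
  "P = convex hull (incidence_vector ` C)"

text \<open>Only the values at covered vertices are constrained. As both types are finite, there are
  still finitely many choices.\<close>

definition choices :: "('v \<Rightarrow> 'n) set" where
  "choices = {\<phi>. \<forall>v\<in>\<Union>(vs ` I). \<phi> v \<in> I \<and> v \<in> vs (\<phi> v)}"

text \<open>Integral and zero outside \<open>I\<close>, so these are lattice points of the
  coordinate space.\<close>

definition normal :: "('v \<Rightarrow> 'n) \<Rightarrow> real ^ 'n" where
  "normal \<phi> = (\<chi> i. if i \<in> I
     then 1 - real (card (vs i)) + real (card {v \<in> \<Union>(vs ` I). \<phi> v = i}) else 0)"

lemma convex_P: "convex P"
  by (simp add: P_def)

lemma C_in_P: "A \<in> C \<Longrightarrow> incidence_vector A \<in> P"
  by (simp add: P_def hull_inc)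

lemma zero_in_P: "0 \<in> P"
proof -
  have "incidence_vector {} = (0 :: real ^ 'n)" by (simp add: incidence_vector_def vec_eq_iff)
  then show ?thesis using C_in_P[OF C_empty] by simp
qed

text \<open>The fibres of \<open>\<phi>\<close> are disjoint, so their sizes add up. The value
  differs from \<open>euler A\<close> only in counting the vertices sent into \<open>A\<close>
  instead of those covered by \<open>A\<close>.\<close>

lemma normal_incidence_vector:
  assumes "A \<subseteq> I"
  shows "normal \<phi> \<bullet> incidence_vector A =
    real (card {v \<in> \<Union>(vs ` I). \<phi> v \<in> A}) + (\<Sum>i\<in>A. 1 - real (card (vs i)))"
proof -
  have "{v \<in> \<Union>(vs ` I). \<phi> v \<in> A} = (\<Union>i\<in>A. {v \<in> \<Union>(vs ` I). \<phi> v = i})" by auto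
  then have "card {v \<in> \<Union>(vs ` I). \<phi> v \<in> A} = (\<Sum>i\<in>A. card {v \<in> \<Union>(vs ` I). \<phi> v = i})"
    by (simp only:) (rule card_UN_disjoint, auto)
  moreover have "normal \<phi> \<bullet> incidence_vector A =
    (\<Sum>i\<in>A. 1 - real (card (vs i)) + real (card {v \<in> \<Union>(vs ` I). \<phi> v = i}))"
    unfolding inner_incidence_vector normal_def using assms by (intro sum.cong) auto
  ultimately show ?thesis by (simp add: sum.distrib)
qed

text \<open>Every covered vertex is sent into \<open>I\<close>, so the value is the Euler count of
  the connected family \<open>I\<close>; for empty \<open>I\<close> that count would be 0.\<close>

lemma normal_top:
  assumes "I \<noteq> {}" "\<phi> \<in> choices"
  shows "normal \<phi> \<bullet> incidence_vector I = 1"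
proof -
  have "{v \<in> \<Union>(vs ` I). \<phi> v \<in> I} = \<Union>(vs ` I)" using assms(2) by (auto simp: choices_def)
  then show ?thesis using C_euler[OF C_top assms(1)] by (simp add: normal_incidence_vector)
qed

text \<open>A choice sends a covered vertex into \<open>A\<close> only if \<open>A\<close> covers
  it, so the value is at most the Euler count, which is 1 on a nonempty connected family.\<close>

lemma normal_le:
  assumes "A \<in> C" "\<phi> \<in> choices"
  shows "normal \<phi> \<bullet> incidence_vector A \<le> 1"
proof (cases "A = {}")
  case True
  then show ?thesis by (simp add: inner_incidence_vector)
next
  case False
  have "{v \<in> \<Union>(vs ` I). \<phi> v \<in> A} \<subseteq> \<Union>(vs ` A)" using assms(2) by (auto simp: choices_def)
  then have "card {v \<in> \<Union>(vs ` I). \<phi> v \<in> A} \<le> card (\<Union>(vs ` A))" by (intro card_mono) auto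
  then show ?thesis
    using C_euler[OF assms(1) False] C_sub[OF assms(1)] by (simp add: normal_incidence_vector)
qed

section \<open>Decompositions in the cone over \<open>P\<close>\<close>

text \<open>Points of the cone are written as a weight times a point of \<open>P\<close>; by
  convexity the weights add up.\<close>

lemma cone_add:
  assumes "p \<in> P" "q \<in> P" "s \<ge> 0" "t \<ge> 0"
  obtains r where "r \<in> P" "s *\<^sub>R p + t *\<^sub>R q = (s + t) *\<^sub>R r"
proof (cases "s + t = 0")
  case True
  then have "s = 0" "t = 0" using assms by auto
  then show ?thesis using that[of p] assms by simp
next
  case False
  let ?r = "(s / (s + t)) *\<^sub>R p + (t / (s + t)) *\<^sub>R q"
  have "?r \<in> P" using False assms convex_P
    by (intro convexD) (auto simp: add_divide_distrib[symmetric])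
  moreover have "s *\<^sub>R p + t *\<^sub>R q = (s + t) *\<^sub>R ?r"
    using False by (simp add: scaleR_right_distrib)
  ultimately show ?thesis using that by blast
qed

text \<open>Each component split off is a generator of \<open>P\<close> with weight 1 and lowers
  \<open>euler\<close> by 1, so \<open>incidence_vector A\<close> is a sum of generators of total
  weight \<open>euler A\<close>.\<close>

lemma incidence_vector_decomposition:
  assumes "A \<subseteq> I"
  shows "euler A \<ge> 0 \<and> (\<exists>p\<in>P. incidence_vector A = euler A *\<^sub>R p)"
  using assms
proof (induction "card A" arbitrary: A rule: less_induct)
  case less
  show ?case
  proof (cases "A = {}")
    case True
    then have "incidence_vector A = (0 :: real ^ 'n)" "euler A = 0"
      by (simp_all add: incidence_vector_def vec_eq_iff euler_def)
    then show ?thesis using zero_in_P by auto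
  next
    case False
    then obtain S where S: "S \<in> C" "S \<noteq> {}" "S \<subseteq> A" "\<Union>(vs ` S) \<inter> \<Union>(vs ` (A - S)) = {}"
      using C_component less.prems by blast
    have "card (A - S) < card A" using S by (intro psubset_card_mono) auto
    with less obtain q where q: "euler (A - S) \<ge> 0" "q \<in> P"
      "incidence_vector (A - S) = euler (A - S) *\<^sub>R q" by blast
    have "\<Union>(vs ` A) = \<Union>(vs ` S) \<union> \<Union>(vs ` (A - S))" using S(3) by auto
    then have "card (\<Union>(vs ` A)) = card (\<Union>(vs ` S)) + card (\<Union>(vs ` (A - S)))"
      using S(4) by (simp add: card_Un_disjoint)
    moreover have "(\<Sum>i\<in>A. 1 - real (card (vs i))) =
        (\<Sum>i\<in>A - S. 1 - real (card (vs i))) + (\<Sum>i\<in>S. 1 - real (card (vs i)))"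
      using S(3) by (intro sum.subset_diff) auto
    ultimately have e: "euler A = 1 + euler (A - S)"
      using C_euler[OF S(1,2)] by (simp add: euler_def)
    have "incidence_vector A = incidence_vector S + (incidence_vector (A - S) :: real ^ 'n)"
      using S(3) by (auto simp: incidence_vector_def vec_eq_iff)
    also have "\<dots> = 1 *\<^sub>R incidence_vector S + euler (A - S) *\<^sub>R q" using q(3) by simp
    finally show ?thesis
      using cone_add[of "incidence_vector S" q 1 "euler (A - S)"] C_in_P[OF S(1)] q e by force
  qed
qed

text \<open>
  Peeling off the smallest positive value of \<open>x\<close> decomposes \<open>x\<close> along its level sets; on these
  the linear functional \<open>normal \<phi>\<close> agrees with the Euler characteristic because \<open>\<phi>\<close>
  selects a maximal coordinate at every vertex.
\<close>

lemma nonneg_decomposition: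
  assumes "x \<in> coord_space I" "\<And>i. x $ i \<ge> 0" "\<phi> \<in> choices"
    and "\<And>i v. i \<in> I \<Longrightarrow> v \<in> vs i \<Longrightarrow> x $ i \<le> x $ \<phi> v"
  shows "normal \<phi> \<bullet> x \<ge> 0 \<and> (\<exists>p\<in>P. x = (normal \<phi> \<bullet> x) *\<^sub>R p)"
  using assms
proof (induction "card {i. x $ i \<noteq> 0}" arbitrary: x rule: less_induct)
  case less
  define A where "A = {i. x $ i \<noteq> 0}"
  show ?case
  proof (cases "A = {}")
    case True
    then have "x = 0" by (auto simp: A_def vec_eq_iff)
    then show ?thesis using zero_in_P by auto
  next
    case False
    have A: "A \<subseteq> I" using less.prems(1) by (auto simp: A_def coord_space_def)
    define m where "m = Min ((\<lambda>i. x $ i) ` A)"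
    have "m \<in> (\<lambda>i. x $ i) ` A" unfolding m_def using False by (intro Min_in) auto
    then obtain j where j: "j \<in> A" "x $ j = m" by auto
    have le: "m \<le> x $ i" if "i \<in> A" for i unfolding m_def using that by simp
    have m: "m > 0" using j less.prems(2)[of j] by (auto simp: A_def)
    define x' where "x' = x - m *\<^sub>R incidence_vector A"
    have x'_nth: "x' $ i = (if i \<in> A then x $ i - m else 0)" for i
      by (auto simp: x'_def incidence_vector_def A_def)
    have "{i. x' $ i \<noteq> 0} \<subset> {i. x $ i \<noteq> 0}"
      using j by (auto simp: x'_nth A_def)
    then have "card {i. x' $ i \<noteq> 0} < card {i. x $ i \<noteq> 0}" by (intro psubset_card_mono) auto
    moreover have "x' \<in> coord_space I" using A by (auto simp: coord_space_def x'_nth)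
    moreover have "x' $ i \<ge> 0" for i using le by (simp add: x'_nth)
    \<comment> \<open>If \<open>x $ i\<close> is positive, then so is \<open>x $ \<phi> v\<close>,
      and \<open>m\<close> is subtracted from both; otherwise the left side is 0. Thus
      \<open>\<phi>\<close> still selects maximal coordinates.\<close>
    moreover have "x' $ i \<le> x' $ \<phi> v" if "i \<in> I" "v \<in> vs i" for i v
      using less.prems(4)[OF that] less.prems(2)[of i] le[of "\<phi> v"]
      by (auto simp: x'_nth A_def split: if_splits)
    ultimately obtain q where q: "normal \<phi> \<bullet> x' \<ge> 0" "q \<in> P" "x' = (normal \<phi> \<bullet> x') *\<^sub>R q"
      using less.hyps[of x'] less.prems(3) by blast
    have "{v \<in> \<Union>(vs ` I). \<phi> v \<in> A} = \<Union>(vs ` A)"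
    proof (intro equalityI subsetI)
      fix v assume "v \<in> \<Union>(vs ` A)"
      then obtain i where i: "i \<in> A" "v \<in> vs i" by auto
      with A have "x $ i \<le> x $ \<phi> v" using less.prems(4) by auto
      with i less.prems(2)[of i] have "\<phi> v \<in> A" by (auto simp: A_def)
      with i A show "v \<in> {v \<in> \<Union>(vs ` I). \<phi> v \<in> A}" by auto
    qed (use less.prems(3) in \<open>auto simp: choices_def\<close>)
    then have e: "normal \<phi> \<bullet> incidence_vector A = euler A"
      using A by (simp add: normal_incidence_vector euler_def)
    obtain p where p: "euler A \<ge> 0" "p \<in> P" "incidence_vector A = euler A *\<^sub>R p"
      using incidence_vector_decomposition[OF A] by blast
    have eq: "x = m *\<^sub>R incidence_vector A + x'" by (simp add: x'_def)
    then have n: "normal \<phi> \<bullet> x = m * euler A + normal \<phi> \<bullet> x'"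
      using e by (metis inner_add_right inner_scaleR_right)
    obtain r where r: "r \<in> P"
      "(m * euler A) *\<^sub>R p + (normal \<phi> \<bullet> x') *\<^sub>R q = (m * euler A + normal \<phi> \<bullet> x') *\<^sub>R r"
      using cone_add[of p q "m * euler A" "normal \<phi> \<bullet> x'"] p q m by auto
    have "x = (m * euler A) *\<^sub>R p + (normal \<phi> \<bullet> x') *\<^sub>R q"
      using eq p(3) q(3) by (metis scaleR_scaleR)
    also note r(2)
    finally show ?thesis using n r(1) p(1) q(1) m by auto
  qed
qed

section \<open>Inequality description and full dimension\<close>

text \<open>The inequalities are checked on the generators. Conversely, for a \<open>\<phi>\<close>
  adapted to \<open>x\<close>, the decomposition gives \<open>x\<close> the weight
  \<open>normal \<phi> \<bullet> x\<close>, which is between 0 and 1, so \<open>x\<close> lies on a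
  segment from the origin to a point of \<open>P\<close>.\<close>

lemma P_inequalities:
  "P = {x \<in> coord_space I. (\<forall>i. x $ i \<ge> 0) \<and> (\<forall>\<phi>\<in>choices. normal \<phi> \<bullet> x \<le> 1)}" (is "_ = ?R")
proof (intro equalityI subsetI)
  have "convex ?R"
  proof -
    have "?R = coord_space I \<inter> (\<Inter>i. {x. axis i 1 \<bullet> x \<ge> 0}) \<inter> (\<Inter>\<phi>\<in>choices. {x. normal \<phi> \<bullet> x \<le> 1})"
      by (auto simp: inner_axis')
    then show ?thesis
      by (simp add: convex_Int convex_INT convex_halfspace_le convex_halfspace_ge
          subspace_imp_convex subspace_coord_space)
  qed
  moreover have "incidence_vector ` C \<subseteq> ?R"
  proof (rule image_subsetI)
    fix A assume "A \<in> C"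
    then have "incidence_vector A \<in> coord_space I"
      using incidence_vector_int_lattice[OF C_sub] by (auto simp: int_lattice_def)
    then show "incidence_vector A \<in> ?R"
      using normal_le[OF \<open>A \<in> C\<close>] by (auto simp: incidence_vector_def)
  qed
  ultimately have "P \<subseteq> ?R" unfolding P_def by (intro hull_minimal)
  then show "x \<in> ?R" if "x \<in> P" for x using that by auto
  show "x \<in> P" if x: "x \<in> ?R" for x
  proof -
    \<comment> \<open>At each covered vertex \<open>\<phi>\<close> picks an index with the largest
      coordinate of \<open>x\<close>; elsewhere its value is arbitrary.\<close>
    define \<phi> where "\<phi> = (\<lambda>v. SOME i. i \<in> I \<and> v \<in> vs i \<and> (\<forall>j\<in>I. v \<in> vs j \<longrightarrow> x $ j \<le> x $ i))"
    have \<phi>: "\<phi> v \<in> I \<and> v \<in> vs (\<phi> v) \<and> (\<forall>j\<in>I. v \<in> vs j \<longrightarrow> x $ j \<le> x $ \<phi> v)"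
      if "v \<in> \<Union>(vs ` I)" for v
      unfolding \<phi>_def
    proof (rule someI_ex)
      let ?J = "{i \<in> I. v \<in> vs i}"
      have "?J \<noteq> {}" using that by auto
      then have "Max ((\<lambda>i. x $ i) ` ?J) \<in> (\<lambda>i. x $ i) ` ?J" by (intro Max_in) auto
      then obtain i where "i \<in> ?J" "x $ i = Max ((\<lambda>i. x $ i) ` ?J)" by auto
      then show "\<exists>i. i \<in> I \<and> v \<in> vs i \<and> (\<forall>j\<in>I. v \<in> vs j \<longrightarrow> x $ j \<le> x $ i)"
        by (intro exI[of _ i]) auto
    qed
    then have ch: "\<phi> \<in> choices" by (auto simp: choices_def)
    obtain p where p: "normal \<phi> \<bullet> x \<ge> 0" "p \<in> P" "x = (normal \<phi> \<bullet> x) *\<^sub>R p"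
      using nonneg_decomposition[of x \<phi>] x ch \<phi> by blast
    have "(1 - normal \<phi> \<bullet> x) *\<^sub>R 0 + (normal \<phi> \<bullet> x) *\<^sub>R p \<in> P"
      using convex_P zero_in_P p x ch by (intro convexD) auto
    then show ?thesis using p(3) by simp
  qed
qed

text \<open>The origin turns the affine hull into the span, and the singletons in \<open>C\<close>
  supply the unit vectors.\<close>

lemma full_dimensional_P: "full_dimensional I P"
proof -
  have "0 \<in> affine hull P" using zero_in_P by (simp add: hull_inc)
  then have "affine hull P = span P" by (rule affine_hull_span_0)
  also have "\<dots> = coord_space I"
  proof (intro equalityI subsetI)
    show "x \<in> coord_space I" if "x \<in> span P" for x
      using that span_minimal[of P "coord_space I"] subspace_coord_space P_inequalities by blast
    show "x \<in> span P" if x: "x \<in> coord_space I" for x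
    proof -
      have "x = (\<Sum>i\<in>I. x $ i *\<^sub>R incidence_vector {i})"
        using x by (auto simp: vec_eq_iff coord_space_def incidence_vector_def if_distrib
            sum.delta cong: if_cong)
      also have "\<dots> \<in> span P"
        using C_in_P C_single by (intro span_sum span_scale span_base) auto
      finally show ?thesis .
    qed
  qed
  finally show ?thesis by (simp add: full_dimensional_def)
qed

text \<open>
  The functionals \<open>normal \<phi>\<close> take the value 1 at the all-ones vector \<open>w\<close>, so every facet of
  \<open>2 P - w\<close> has lattice distance \<open>2 - 1 = 1\<close> from the origin.
\<close>

theorem gorenstein_P: "gorenstein I 2 P"
proof -
  define w :: "real ^ 'n" where "w = incidence_vector I"
  define Q where "Q = (\<lambda>x. real 2 *\<^sub>R x - w) ` P"
  \<comment> \<open>For empty \<open>I\<close> the space is a single point and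
    \<open>normal_top\<close> does not apply; \<open>V\<close> is then taken empty.\<close>
  define V where "V = (if I = {} then {} else normal ` choices \<union> (\<lambda>i. - incidence_vector {i}) ` I)"
  have w: "w \<in> int_lattice I" by (simp add: w_def incidence_vector_int_lattice)
  then have wc: "w \<in> coord_space I" by (simp add: int_lattice_def)
  have finV: "finite V" by (auto simp: V_def)
  have VI: "V \<subseteq> int_lattice I"
    by (auto simp: V_def normal_def int_lattice_def coord_space_def incidence_vector_def)
  have C_lattice: "incidence_vector ` C \<subseteq> int_lattice I"
    using C_sub incidence_vector_int_lattice by blast
  then have latP: "lattice_polytope I P"
    unfolding lattice_polytope_def P_def by (intro exI[of _ "incidence_vector ` C"]) auto
  have "Q = convex hull ((\<lambda>x. real 2 *\<^sub>R x - w) ` incidence_vector ` C)"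
    unfolding Q_def P_def using convex_hull_affinity[of "-w" 2 "incidence_vector ` C"] by simp
  moreover have "(\<lambda>x. real 2 *\<^sub>R x - w) ` incidence_vector ` C \<subseteq> int_lattice I"
    using C_lattice w by (auto simp: int_lattice_def coord_space_def)
  ultimately have latQ: "lattice_polytope I Q"
    unfolding lattice_polytope_def by (metis finite_imageI finite)
  have Q: "Q = {y \<in> coord_space I. \<forall>a\<in>V. a \<bullet> y \<le> 1}"
  proof (cases "I = {}")
    case True
    then have "coord_space I = {0 :: real ^ 'n}" by (auto simp: coord_space_def vec_eq_iff)
    moreover have "P = {0}" using calculation P_inequalities zero_in_P by auto
    ultimately show ?thesis using True wc by (simp add: Q_def V_def)
  next
    case False
    have in_Q: "y \<in> Q \<longleftrightarrow> (1 / 2) *\<^sub>R (y + w) \<in> P" for y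
    proof
      assume "(1 / 2) *\<^sub>R (y + w) \<in> P"
      moreover have "y = real 2 *\<^sub>R ((1 / 2) *\<^sub>R (y + w)) - w" by simp
      ultimately show "y \<in> Q" unfolding Q_def by (rule rev_image_eqI)
    qed (auto simp: Q_def)
    have coord: "(1 / 2) *\<^sub>R (y + w) \<in> coord_space I \<longleftrightarrow> y \<in> coord_space I" for y
      using wc by (auto simp: coord_space_def)
    \<comment> \<open>Both sides say \<open>y $ i \<ge> -1\<close> on \<open>I\<close>, because
      \<open>w\<close> has coordinate 1 there.\<close>
    have nonneg: "(\<forall>i. ((1 / 2) *\<^sub>R (y + w)) $ i \<ge> 0) \<longleftrightarrow> (\<forall>i\<in>I. - incidence_vector {i} \<bullet> y \<le> 1)"
      if "y \<in> coord_space I" for y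
    proof -
      have "- incidence_vector {i} \<bullet> y = - (y $ i)" for i
        using inner_incidence_vector[of y "{i}"] by (simp add: inner_commute)
      then show ?thesis using that
        by (auto simp: w_def incidence_vector_def coord_space_def)
    qed
    have facet: "(\<forall>\<phi>\<in>choices. normal \<phi> \<bullet> ((1 / 2) *\<^sub>R (y + w)) \<le> 1) \<longleftrightarrow>
        (\<forall>\<phi>\<in>choices. normal \<phi> \<bullet> y \<le> 1)" for y
      using normal_top[OF False] by (intro ball_cong) (auto simp: inner_add_right w_def)
    have V_iff: "(\<forall>a\<in>V. a \<bullet> y \<le> 1) \<longleftrightarrow>
        (\<forall>i\<in>I. - incidence_vector {i} \<bullet> y \<le> 1) \<and> (\<forall>\<phi>\<in>choices. normal \<phi> \<bullet> y \<le> 1)" for y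
      using False by (auto simp: V_def ball_Un)
    show ?thesis
      unfolding set_eq_iff in_Q P_inequalities mem_Collect_eq coord facet V_iff
      using nonneg by (intro allI conj_cong refl)
  qed
  have "dual_polytope I Q = convex hull (insert 0 V)"
    unfolding Q using finV VI by (intro dual_polytope_inequalities) (auto simp: int_lattice_def)
  moreover have "insert 0 V \<subseteq> int_lattice I"
    using VI by (auto simp: int_lattice_def coord_space_def)
  ultimately have "lattice_polytope I (dual_polytope I Q)"
    unfolding lattice_polytope_def using finV by blast
  moreover have "0 \<in> top_of_set (coord_space I) interior_of Q"
    unfolding Q by (rule zero_interior_inequalities[OF finV])
  moreover have "full_dimensional I Q"
    unfolding Q_def using full_dimensional_P wc by (intro full_dimensional_affinity) auto
  ultimately have "reflexive I Q" using latQ by (simp add: reflexive_def)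
  then show ?thesis
    unfolding gorenstein_def using latP full_dimensional_P w Q_def by blast
qed

end


section \<open>Nonseparable graphs and blocks\<close>

text \<open>Such sets cut out unions of components without mentioning walks. They may contain
  elements that are not vertices, so complements can be taken in the whole type.\<close>

definition edge_closed :: "'v graph \<Rightarrow> 'v set \<Rightarrow> bool" where
  "edge_closed G K \<longleftrightarrow> (\<forall>x y. {x, y} \<in> edges G \<longrightarrow> x \<in> K \<longrightarrow> y \<in> K)"

lemma edge_closedI: "(\<And>x y. {x, y} \<in> edges G \<Longrightarrow> x \<in> K \<Longrightarrow> y \<in> K) \<Longrightarrow> edge_closed G K"
  by (auto simp: edge_closed_def)

lemma edge_closedD: "edge_closed G K \<Longrightarrow> {x, y} \<in> edges G \<Longrightarrow> x \<in> K \<Longrightarrow> y \<in> K"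
  by (auto simp: edge_closed_def)

lemma edge_closed_compl: "edge_closed G K \<Longrightarrow> edge_closed G (- K)"
  using edge_closedD[of G K] by (intro edge_closedI) (metis ComplD ComplI insert_commute)

lemma edge_closed_mono: "edge_closed G K \<Longrightarrow> edges H \<subseteq> edges G \<Longrightarrow> edge_closed H K"
  unfolding edge_closed_def by blast

text \<open>A walk cannot leave an edge-closed set; conversely, the set reachable from a vertex is
  edge-closed. Most connectivity proofs below use such sets instead of walks.\<close>

lemma connected_graph_iff:
  "connected_graph G \<longleftrightarrow> (\<forall>K. edge_closed G K \<longrightarrow> K \<inter> verts G \<noteq> {} \<longrightarrow> verts G \<subseteq> K)"
proof (intro iffI allI impI)
  fix K assume G: "connected_graph G" and K: "edge_closed G K" "K \<inter> verts G \<noteq> {}"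
  then obtain u where u: "u \<in> K" "u \<in> verts G" by auto
  show "verts G \<subseteq> K"
  proof
    fix v assume "v \<in> verts G"
    with G u have "(u, v) \<in> {(x, y). {x, y} \<in> edges G}\<^sup>*"
      by (auto simp: connected_graph_def reach_def)
    then show "v \<in> K" using u(1) K(1) by induction (auto dest: edge_closedD)
  qed
next
  assume *: "\<forall>K. edge_closed G K \<longrightarrow> K \<inter> verts G \<noteq> {} \<longrightarrow> verts G \<subseteq> K"
  show "connected_graph G" unfolding connected_graph_def
  proof (intro ballI)
    fix u v assume uv: "u \<in> verts G" "v \<in> verts G"
    let ?K = "{w. (u, w) \<in> {(x, y). {x, y} \<in> edges G}\<^sup>*}"
    have "edge_closed G ?K"
    proof (rule edge_closedI)
      fix x y assume "{x, y} \<in> edges G" "x \<in> ?K"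
      then show "y \<in> ?K" using rtrancl_into_rtrancl[of u x _ y] by auto
    qed
    moreover have "u \<in> ?K" by simp
    ultimately have "verts G \<subseteq> ?K" using * uv by blast
    with uv show "(u, v) \<in> reach G" by (auto simp: reach_def)
  qed
qed

lemma connected_graphD:
  "connected_graph G \<Longrightarrow> edge_closed G K \<Longrightarrow> x \<in> K \<Longrightarrow> x \<in> verts G \<Longrightarrow> y \<in> verts G \<Longrightarrow> y \<in> K"
  unfolding connected_graph_iff by blast

lemma connected_graphI:
  "(\<And>K x y. edge_closed G K \<Longrightarrow> x \<in> K \<Longrightarrow> x \<in> verts G \<Longrightarrow> y \<in> verts G \<Longrightarrow> y \<in> K) \<Longrightarrow> connected_graph G"
  unfolding connected_graph_iff by blast

lemma simple_graph_edge:
  assumes "simple_graph G" "e \<in> edges G"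
  obtains x y where "e = {x, y}" "x \<noteq> y" "x \<in> verts G" "y \<in> verts G"
proof -
  have "e \<subseteq> verts G" "card e = 2" using assms by (auto simp: simple_graph_def)
  then show ?thesis using that by (auto simp: card_2_iff)
qed

lemma connected_graph_has_edge:
  assumes "connected_graph G" "card (verts G) \<ge> 2"
  shows "edges G \<noteq> {}"
proof
  assume "edges G = {}"
  then have *: "edge_closed G K" for K by (simp add: edge_closed_def)
  obtain x y where "x \<in> verts G" "y \<in> verts G" "x \<noteq> y"
    using assms(2) unfolding numeral_2_eq_2 card_le_Suc_iff by auto
  then show False using connected_graphD[OF assms(1) *, of x "{x}" y] by simp
qed

lemma reach_connected:
  assumes "connected_graph G"
  shows "reach G = verts G \<times> verts G"
  using assms by (auto simp: connected_graph_def reach_def)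

text \<open>A connected graph with a vertex has one component, a disconnected finite graph at least
  two, and deleting an edge keeps the vertices.\<close>

lemma bridge_iff:
  fixes G :: "'v graph"
  assumes "simple_graph G" "connected_graph G"
  shows "bridge G e \<longleftrightarrow> e \<in> edges G \<and> \<not> connected_graph (delete_edge G e)"
proof -
  have one: "num_components H = 1" if "connected_graph H" "verts H \<noteq> {}" for H :: "'v graph"
  proof -
    have "verts H // reach H = {verts H}"
      using that unfolding reach_connected[OF that(1)] quotient_def by auto
    then show ?thesis by (simp add: num_components_def)
  qed
  have many: "num_components H > 1" if H: "\<not> connected_graph H" "finite (verts H)" for H :: "'v graph"
  proof -
    obtain u v where uv: "u \<in> verts H" "v \<in> verts H" "(u, v) \<notin> reach H"
      using H by (auto simp: connected_graph_def)
    have refl: "(x, x) \<in> reach H" if "x \<in> verts H" for x using that by (simp add: reach_def)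
    have "{reach H `` {u}, reach H `` {v}} \<subseteq> verts H // reach H"
      using uv by (auto simp: quotientI)
    moreover have "finite (verts H // reach H)"
      using H(2) unfolding quotient_def by auto
    ultimately have "card {reach H `` {u}, reach H `` {v}} \<le> num_components H"
      unfolding num_components_def by (intro card_mono)
    moreover have "reach H `` {u} \<noteq> reach H `` {v}" using uv refl by blast
    ultimately show ?thesis by simp
  qed
  show ?thesis
  proof (cases "e \<in> edges G")
    case True
    with assms(1) have "verts G \<noteq> {}" by (auto elim: simple_graph_edge)
    moreover have "finite (verts G)" using assms(1) by (simp add: simple_graph_def)
    ultimately show ?thesis
      using one[of G] one[of "delete_edge G e"] many[of "delete_edge G e"] assms True
      by (auto simp: bridge_def delete_edge_def)
  qed (simp add: bridge_def)
qed

section \<open>Unions of graphs, nonseparable graphs and ears\<close>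

definition join :: "'v graph \<Rightarrow> 'v graph \<Rightarrow> 'v graph" where
  "join G H = (verts G \<union> verts H, edges G \<union> edges H)"

lemma join_sel [simp]: "verts (join G H) = verts G \<union> verts H" "edges (join G H) = edges G \<union> edges H"
  by (simp_all add: join_def)

lemma delete_vertex_sel [simp]:
  "verts (delete_vertex G v) = verts G - {v}" "edges (delete_vertex G v) = {e \<in> edges G. v \<notin> e}"
  by (simp_all add: delete_vertex_def)

lemma delete_edge_sel [simp]:
  "verts (delete_edge G e) = verts G" "edges (delete_edge G e) = edges G - {e}"
  by (simp_all add: delete_edge_def)

lemma graph_Union_sel [simp]:
  "verts (graph_Union \<A>) = (\<Union>B\<in>\<A>. verts B)" "edges (graph_Union \<A>) = (\<Union>B\<in>\<A>. edges B)"
  by (simp_all add: graph_Union_def)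

lemma graph_Union_single [simp]: "graph_Union {B} = B"
  by (simp add: prod_eq_iff)

lemma simple_graph_join: "simple_graph G \<Longrightarrow> simple_graph H \<Longrightarrow> simple_graph (join G H)"
  by (auto simp: simple_graph_def)

lemma subgraph_join: "subgraph G K \<Longrightarrow> subgraph H K \<Longrightarrow> subgraph (join G H) K"
  by (auto simp: subgraph_def simple_graph_join)

lemma delete_vertex_join: "delete_vertex (join G H) v = join (delete_vertex G v) (delete_vertex H v)"
  by (auto simp: prod_eq_iff)

text \<open>An edge-closed set meeting either part contains the common vertex and therefore both
  parts.\<close>

lemma connected_graph_join:
  assumes "connected_graph G" "connected_graph H" "verts G \<inter> verts H \<noteq> {}"
  shows "connected_graph (join G H)"
proof (rule connected_graphI)
  fix K x y assume K: "edge_closed (join G H) K" "x \<in> K" "x \<in> verts (join G H)" "y \<in> verts (join G H)"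
  obtain z where z: "z \<in> verts G" "z \<in> verts H" using assms(3) by auto
  have G: "edge_closed G K" and H: "edge_closed H K" using K(1) by (auto intro: edge_closed_mono)
  have "z \<in> K" using K z connected_graphD[OF assms(1) G, of x z] connected_graphD[OF assms(2) H, of x z] by auto
  then show "y \<in> K" using K z connected_graphD[OF assms(1) G, of z y] connected_graphD[OF assms(2) H, of z y] by auto
qed

text \<open>Single edges count as nonseparable, which allows a uniform treatment of both kinds of blocks.\<close>

definition nonseparable :: "'v graph \<Rightarrow> bool" where
  "nonseparable G \<longleftrightarrow> simple_graph G \<and> connected_graph G \<and> card (verts G) \<ge> 2 \<and>
     (\<forall>v. connected_graph (delete_vertex G v))"

text \<open>Deleting a vertex that is not there leaves a simple graph unchanged, which reconciles
  the two ranges of the quantifier over \<open>v\<close>.\<close>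

lemma two_connected_iff_nonseparable:
  assumes "simple_graph G"
  shows "two_connected G \<longleftrightarrow> nonseparable G \<and> card (verts G) \<ge> 3"
proof -
  have "delete_vertex G v = G" if "v \<notin> verts G" for v
    using assms that by (auto simp: prod_eq_iff simple_graph_def)
  then show ?thesis using assms unfolding two_connected_def nonseparable_def by auto
qed

lemma nonseparable_edge:
  assumes "card e = 2"
  shows "nonseparable (e, {e})"
proof -
  obtain x y where e: "e = {x, y}" "x \<noteq> y" using assms by (auto simp: card_2_iff)
  have "connected_graph (e, {e})"
    by (rule connected_graphI) (auto simp: e edge_closed_def insert_commute)
  moreover have "connected_graph (delete_vertex (e, {e}) v)" for v
    by (rule connected_graphI) (auto simp: e edge_closed_def insert_commute)
  ultimately show ?thesis using assms e by (simp add: nonseparable_def simple_graph_def)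
qed

lemma nonseparable_card_2:
  assumes "nonseparable G" "card (verts G) = 2"
  shows "edges G = {verts G}"
proof -
  have "e = verts G" if "e \<in> edges G" for e
    using assms that unfolding nonseparable_def simple_graph_def by (metis card_subset_eq)
  moreover have "edges G \<noteq> {}" using assms by (intro connected_graph_has_edge) (auto simp: nonseparable_def)
  ultimately show ?thesis by blast
qed

text \<open>After any one deletion a common vertex survives, so the two remaining connected parts
  still overlap.\<close>

lemma nonseparable_join:
  assumes G: "nonseparable G" and H: "nonseparable H" and c: "card (verts G \<inter> verts H) \<ge> 2"
  shows "nonseparable (join G H)"
proof -
  have fin: "finite (verts G)" "finite (verts H)" using G H by (auto simp: nonseparable_def simple_graph_def)
  have "connected_graph (delete_vertex (join G H) v)" for v
    unfolding delete_vertex_join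
  proof (rule connected_graph_join)
    have "\<not> verts G \<inter> verts H \<subseteq> {v}" using c card_mono[of "{v}" "verts G \<inter> verts H"] by auto
    then show "verts (delete_vertex G v) \<inter> verts (delete_vertex H v) \<noteq> {}" by auto
  qed (use G H in \<open>auto simp: nonseparable_def\<close>)
  moreover have "connected_graph (join G H)"
    using G H c by (intro connected_graph_join) (auto simp: nonseparable_def)
  moreover have "card (verts G \<union> verts H) \<ge> 2"
    using G fin card_mono[of "verts G \<union> verts H" "verts G"] by (auto simp: nonseparable_def)
  ultimately show ?thesis using G H by (simp add: nonseparable_def simple_graph_join)
qed

text \<open>
  Adding an ear: a connected \<open>H\<close> with the fewest vertices among those meeting \<open>B\<close> in at least two
  vertices plays the role of a path with both ends on \<open>B\<close>.
\<close>

lemma nonseparable_ear: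
  assumes B: "nonseparable B" and H: "simple_graph H" "connected_graph H" "card (verts B \<inter> verts H) \<ge> 2"
  shows "\<exists>H'. subgraph H' H \<and> connected_graph H' \<and> card (verts B \<inter> verts H') \<ge> 2 \<and> nonseparable (join B H')"
  using H
proof (induction "card (verts H)" arbitrary: H rule: less_induct)
  case less
  have sub: "subgraph H H" using less.prems by (simp add: subgraph_def)
  have finB: "finite (verts B)" and finH: "finite (verts H)"
    using B less.prems by (auto simp: nonseparable_def simple_graph_def)
  show ?case
  proof (cases "\<forall>z. connected_graph (delete_vertex (join B H) z)")
    case True
    have "connected_graph (join B H)"
      using B less.prems by (intro connected_graph_join) (auto simp: nonseparable_def)
    moreover have "card (verts B \<union> verts H) \<ge> 2"
      using B finB finH card_mono[of "verts B \<union> verts H" "verts B"] by (auto simp: nonseparable_def)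
    ultimately have "nonseparable (join B H)"
      using True B less.prems by (simp add: nonseparable_def simple_graph_join)
    then show ?thesis using sub less.prems by blast
  next
    case False
    then obtain z where "\<not> connected_graph (delete_vertex (join B H) z)" by blast
    then obtain K0 where K0: "edge_closed (delete_vertex (join B H) z) K0"
      "\<exists>x\<in>verts B \<union> verts H - {z}. x \<in> K0" "\<exists>x\<in>verts B \<union> verts H - {z}. x \<notin> K0"
      unfolding connected_graph_iff by auto
    have Bz: "connected_graph (delete_vertex B z)" using B by (auto simp: nonseparable_def)
    have "edge_closed (delete_vertex B z) K0" using K0(1) by (rule edge_closed_mono) auto
    from connected_graphD[OF Bz this] have dich: "verts B - {z} \<subseteq> K0 \<or> (verts B - {z}) \<inter> K0 = {}"
      by auto
    \<comment> \<open>\<open>B\<close> without \<open>z\<close> is connected and so lies on one side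
      of the cut \<open>K0\<close>; \<open>K\<close> is the side that avoids it.\<close>
    obtain K where K: "edge_closed (delete_vertex (join B H) z) K"
      "\<exists>x\<in>verts B \<union> verts H - {z}. x \<in> K" "(verts B - {z}) \<inter> K = {}"
    proof (cases "(verts B - {z}) \<inter> K0 = {}")
      case True
      then show ?thesis using that K0 by blast
    next
      case False
      then show ?thesis using that[of "- K0"] K0 dich edge_closed_compl by blast
    qed
    \<comment> \<open>\<open>L\<close> can be left within \<open>H\<close> only through
      \<open>z\<close>, and removing it from \<open>H\<close> costs no vertex of
      \<open>B\<close>.\<close>
    define L where "L = K - {z}"
    have L: "L \<inter> verts B = {}" "L \<inter> verts H \<noteq> {}" "z \<notin> L" using K(2,3) by (auto simp: L_def)
    have L_closed: "y \<in> L" if "{x, y} \<in> edges H" "x \<in> L" "y \<noteq> z" for x y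
      using edge_closedD[OF K(1), of x y] that by (auto simp: L_def)
    define H' where "H' = (verts H - L, {e \<in> edges H. e \<inter> L = {}})"
    have H'_sel: "verts H' = verts H - L" "edges H' = {e \<in> edges H. e \<inter> L = {}}" by (simp_all add: H'_def)
    have simp: "simple_graph H'" using less.prems by (auto simp: simple_graph_def H'_sel)
    then have subH: "subgraph H' H" by (auto simp: subgraph_def H'_sel)
    have "card (verts H') < card (verts H)"
      using L finH by (intro psubset_card_mono) (auto simp: H'_sel)
    \<comment> \<open>A closed set \<open>M\<close> of the smaller graph yields one of
      \<open>H\<close>: together with \<open>L\<close> if it contains the gate \<open>z\<close>, and
      without \<open>L\<close> otherwise.\<close>
    moreover have "connected_graph H'"
    proof (rule connected_graphI)
      fix M x y assume M: "edge_closed H' M" "x \<in> M" "x \<in> verts H'" "y \<in> verts H'"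
      have M': "y \<in> M" if "{x, y} \<in> edges H" "x \<in> M" "x \<notin> L" "y \<notin> L" for x y
        using edge_closedD[OF M(1), of x y] that by (auto simp: H'_sel)
      show "y \<in> M"
      proof (cases "z \<in> M")
        case True
        have "edge_closed H (M \<union> L)"
          by (rule edge_closedI) (use M' L_closed True in blast)
        then have "y \<in> M \<union> L" using connected_graphD[OF less.prems(2)] M by (auto simp: H'_sel)
        then show ?thesis using M by (auto simp: H'_sel)
      next
        case False
        have "edge_closed H (M - L)"
        proof (rule edge_closedI)
          fix x y assume xy: "{x, y} \<in> edges H" "x \<in> M - L"
          then have "y \<notin> L" using L_closed[of y x] False by (auto simp: insert_commute)
          with xy M' show "y \<in> M - L" by blast
        qed
        then have "y \<in> M - L" using connected_graphD[OF less.prems(2)] M by (auto simp: H'_sel)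
        then show ?thesis by auto
      qed
    qed
    moreover have "verts B \<inter> verts H' = verts B \<inter> verts H" using L by (auto simp: H'_sel)
    ultimately obtain H'' where "subgraph H'' H'" "connected_graph H''"
      "card (verts B \<inter> verts H'') \<ge> 2" "nonseparable (join B H'')"
      using less.hyps[of H'] simp less.prems by auto
    then show ?thesis using subH by (intro exI[of _ H'']) (auto simp: subgraph_def)
  qed
qed

section \<open>Blocks as maximal nonseparable subgraphs\<close>

text \<open>One notion for bridges and 2-connected blocks; by \<open>blocks_eq\<close> it describes
  exactly the blocks of a connected simple graph.\<close>

definition maximal_nonseparable :: "'v graph \<Rightarrow> 'v graph \<Rightarrow> bool" where
  "maximal_nonseparable G B \<longleftrightarrow> subgraph B G \<and> nonseparable B \<and>
     (\<forall>N. subgraph N G \<longrightarrow> nonseparable N \<longrightarrow> subgraph B N \<longrightarrow> N = B)"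

lemma maximal_nonseparableD:
  "maximal_nonseparable G B \<Longrightarrow> subgraph N G \<Longrightarrow> nonseparable N \<Longrightarrow> subgraph B N \<Longrightarrow> N = B"
  unfolding maximal_nonseparable_def by blast

text \<open>Two common vertices would give an ear \<open>H'\<close> with an edge such that
  \<open>join B H'\<close> is nonseparable. Maximality then puts that edge into \<open>B\<close>,
  against edge-disjointness.\<close>

lemma maximal_nonseparable_ear:
  assumes B: "maximal_nonseparable G B" and H: "subgraph H G" "connected_graph H"
    and disj: "edges B \<inter> edges H = {}"
  shows "card (verts B \<inter> verts H) \<le> 1"
proof (rule ccontr)
  assume "\<not> card (verts B \<inter> verts H) \<le> 1"
  then have "card (verts B \<inter> verts H) \<ge> 2" by simp
  then obtain H' where H': "subgraph H' H" "connected_graph H'"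
    "card (verts B \<inter> verts H') \<ge> 2" "nonseparable (join B H')"
    using nonseparable_ear[of B H] B H by (auto simp: maximal_nonseparable_def subgraph_def)
  have "finite (verts H')" using H' by (auto simp: subgraph_def simple_graph_def)
  then have "card (verts H') \<ge> 2" using H'(3) card_mono[of "verts H'" "verts B \<inter> verts H'"] by simp
  then have "edges H' \<noteq> {}" using H' connected_graph_has_edge by blast
  moreover have "join B H' = B"
  proof -
    have "subgraph H' G" using H' H by (auto simp: subgraph_def)
    then have "subgraph (join B H') G" using B by (simp add: subgraph_join maximal_nonseparable_def)
    moreover have "subgraph B (join B H')" using B by (auto simp: maximal_nonseparable_def subgraph_def)
    ultimately show ?thesis using maximal_nonseparableD[OF B] H' by blast
  qed
  then have "edges H' \<subseteq> edges B" using join_sel(2)[of B H'] by auto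
  ultimately show False using disj H' by (auto simp: subgraph_def)
qed

text \<open>Besides the ends \<open>u\<close> and \<open>v\<close> of \<open>e\<close> there is a
  third vertex \<open>w\<close>. Deleting \<open>v\<close> keeps \<open>u\<close> connected to
  \<open>w\<close>, deleting \<open>u\<close> keeps \<open>v\<close> connected to \<open>w\<close>,
  so \<open>u\<close> and \<open>v\<close> stay connected without \<open>e\<close>.\<close>

lemma nonseparable_edge_not_bridge:
  assumes G: "simple_graph G" "connected_graph G"
    and N: "subgraph N G" "nonseparable N" "card (verts N) \<ge> 3" "e \<in> edges N"
  shows "\<not> bridge G e"
proof -
  have sN: "simple_graph N" and cN: "connected_graph (delete_vertex N v)" for v
    using N by (auto simp: nonseparable_def)
  obtain u v where e: "e = {u, v}" "u \<noteq> v" "u \<in> verts N" "v \<in> verts N"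
    using simple_graph_edge[OF sN N(4)] by blast
  have "\<not> verts N \<subseteq> {u, v}" using N(3) e card_mono[of "{u, v}" "verts N"] by auto
  then obtain w where w: "w \<in> verts N" "w \<noteq> u" "w \<noteq> v" by auto
  have "connected_graph (delete_edge G e)"
  proof (rule connected_graphI)
    fix K x y assume K: "edge_closed (delete_edge G e) K" "x \<in> K"
      "x \<in> verts (delete_edge G e)" "y \<in> verts (delete_edge G e)"
    \<comment> \<open>Edges of \<open>N\<close> that avoid an end \<open>a\<close> of
      \<open>e\<close> differ from \<open>e\<close> and survive in
      \<open>delete_edge G e\<close>.\<close>
    have cl: "edge_closed (delete_vertex N a) K" if "a \<in> e" for a
      using K(1) that N(1) by (auto intro!: edge_closed_mono[OF K(1)] simp: subgraph_def)
    have "u \<in> K \<longleftrightarrow> w \<in> K"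
      using connected_graphD[OF cN[of v] cl[of v], of u w] connected_graphD[OF cN[of v] cl[of v], of w u] e w by auto
    moreover have "v \<in> K \<longleftrightarrow> w \<in> K"
      using connected_graphD[OF cN[of u] cl[of u], of v w] connected_graphD[OF cN[of u] cl[of u], of w v] e w by auto
    ultimately have uv: "u \<in> K \<longleftrightarrow> v \<in> K" by simp
    have "edge_closed G K"
    proof (rule edge_closedI)
      fix a b assume "{a, b} \<in> edges G" "a \<in> K"
      then show "b \<in> K" using edge_closedD[OF K(1), of a b] uv e(1) by (cases "{a, b} = e") (auto simp: doubleton_eq_iff)
    qed
    then show "y \<in> K" using connected_graphD[OF G(2)] K by auto
  qed
  then show ?thesis using G bridge_iff by blast
qed

text \<open>A nonseparable subgraph with three or more vertices contains no bridge, so a bridge with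
  its ends is maximal. Conversely, a maximal one on two vertices is a single edge; if it were no
  bridge, the graph without that edge would meet it in both ends, against
  \<open>maximal_nonseparable_ear\<close>.\<close>

lemma blocks_eq:
  assumes G: "simple_graph G" "connected_graph G"
  shows "blocks G = {B. maximal_nonseparable G B}"
proof (intro equalityI subsetI; unfold mem_Collect_eq)
  fix B assume "B \<in> blocks G"
  then consider (two) "subgraph B G" "two_connected B"
      "\<And>H. subgraph H G \<Longrightarrow> two_connected H \<Longrightarrow> subgraph B H \<Longrightarrow> H = B"
    | (bridge) e where "B = (e, {e})" "bridge G e"
    unfolding blocks_def by blast
  then show "maximal_nonseparable G B"
  proof cases
    case two
    have "N = B" if N: "subgraph N G" "nonseparable N" "subgraph B N" for N
    proof -
      have "finite (verts N)" using N by (auto simp: subgraph_def simple_graph_def)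
      then have "card (verts B) \<le> card (verts N)" using N by (intro card_mono) (auto simp: subgraph_def)
      moreover have "simple_graph N" using N(1) by (simp add: subgraph_def)
      ultimately have "two_connected N"
        using two(2) N(2) two_connected_iff_nonseparable by (fastforce simp: two_connected_def)
      then show ?thesis using two(3) N by blast
    qed
    moreover have "nonseparable B"
      using two(1,2) by (simp add: two_connected_iff_nonseparable subgraph_def)
    ultimately show ?thesis unfolding maximal_nonseparable_def using two(1) by blast
  next
    case bridge
    then have e: "e \<in> edges G" "card e = 2" "e \<subseteq> verts G" using G by (auto simp: bridge_def simple_graph_def)
    then have ns: "nonseparable B" using bridge nonseparable_edge by simp
    have "N = B" if N: "subgraph N G" "nonseparable N" "subgraph B N" for N
    proof -
      have "\<not> card (verts N) \<ge> 3"
        using nonseparable_edge_not_bridge[OF G N(1,2), of e] N(3) bridge by (auto simp: subgraph_def)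
      then have c: "card (verts N) = 2" using N(2) by (auto simp: nonseparable_def)
      have "verts B = e" "edges B = {e}" using bridge by simp_all
      moreover have "edges N = {verts N}" using nonseparable_card_2[OF N(2) c] .
      ultimately show ?thesis using N(3) by (simp add: subgraph_def prod_eq_iff)
    qed
    moreover have "subgraph B G" using ns bridge(1) e by (simp add: subgraph_def nonseparable_def)
    ultimately show ?thesis unfolding maximal_nonseparable_def using ns by blast
  qed
next
  fix B assume B: "maximal_nonseparable G B"
  then have sB: "subgraph B G" "nonseparable B" "simple_graph B" by (auto simp: maximal_nonseparable_def nonseparable_def)
  show "B \<in> blocks G"
  proof (cases "card (verts B) \<ge> 3")
    case True
    then have "two_connected B" using sB by (simp add: two_connected_iff_nonseparable)
    moreover have "H = B" if "subgraph H G" "two_connected H" "subgraph B H" for H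
      using maximal_nonseparableD[OF B that(1) _ that(3)] that
      by (simp add: two_connected_iff_nonseparable subgraph_def)
    ultimately show ?thesis unfolding blocks_def using sB by blast
  next
    case False
    then have c: "card (verts B) = 2" using sB(2) by (auto simp: nonseparable_def)
    define e where "e = verts B"
    have Be: "edges B = {e}" using nonseparable_card_2[OF sB(2) c] by (simp add: e_def)
    have eG: "e \<in> edges G" "e \<subseteq> verts G" using sB Be by (auto simp: subgraph_def e_def)
    have "\<not> connected_graph (delete_edge G e)"
    proof
      assume "connected_graph (delete_edge G e)"
      moreover have "subgraph (delete_edge G e) G" using G by (auto simp: subgraph_def simple_graph_def)
      ultimately have "card (verts B \<inter> verts (delete_edge G e)) \<le> 1"
        using Be by (intro maximal_nonseparable_ear[OF B]) auto
      then show False using c eG by (simp add: e_def inf_absorb1)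
    qed
    then have "bridge G e" using bridge_iff[OF G] eG by blast
    moreover have "B = (e, {e})" using Be by (simp add: e_def prod_eq_iff)
    ultimately show ?thesis unfolding blocks_def by blast
  qed
qed

text \<open>By finiteness, some nonseparable subgraph containing \<open>N\<close> has the most
  vertices plus edges.\<close>

lemma maximal_nonseparable_exists:
  assumes G: "simple_graph G" and N: "subgraph N G" "nonseparable N"
  shows "\<exists>B. maximal_nonseparable G B \<and> subgraph N B"
proof -
  have fv: "finite (verts G)" using G by (simp add: simple_graph_def)
  have fe: "finite (edges G)"
    using G by (intro finite_subset[of "edges G" "Pow (verts G)"]) (auto simp: simple_graph_def)
  let ?f = "\<lambda>B. card (verts B) + card (edges B)"
  let ?P = "\<lambda>B. subgraph B G \<and> nonseparable B \<and> subgraph N B"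
  have "?f B < card (verts G) + card (edges G) + 1" if "?P B" for B
    using that card_mono[OF fv, of "verts B"] card_mono[OF fe, of "edges B"] by (auto simp: subgraph_def)
  moreover have "?P N" using N by (auto simp: subgraph_def)
  ultimately obtain B where B: "?P B" "\<And>M. ?P M \<Longrightarrow> ?f M \<le> ?f B"
    using ex_has_greatest_nat[of ?P N ?f "card (verts G) + card (edges G) + 1"] by auto
  have "M = B" if M: "subgraph M G" "nonseparable M" "subgraph B M" for M
  proof -
    have "?P M" using M B by (auto simp: subgraph_def)
    then have le: "?f M \<le> ?f B" by (rule B(2))
    have sub: "verts B \<subseteq> verts M" "edges B \<subseteq> edges M" using M by (auto simp: subgraph_def)
    have fin: "finite (verts M)" "finite (edges M)" using M fv fe by (auto simp: subgraph_def intro: finite_subset)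
    have "card (verts B) \<le> card (verts M)" "card (edges B) \<le> card (edges M)"
      using sub fin by (auto intro: card_mono)
    with le have "card (verts B) = card (verts M)" "card (edges B) = card (edges M)" by auto
    with sub fin have "verts B = verts M" "edges B = edges M"
      using card_subset_eq by blast+
    then show ?thesis by (simp add: prod_eq_iff)
  qed
  then show ?thesis using B(1) unfolding maximal_nonseparable_def by blast
qed

lemma block_of_edge:
  assumes G: "simple_graph G" "connected_graph G" and e: "e \<in> edges G"
  shows "\<exists>B\<in>blocks G. e \<in> edges B"
proof -
  have "subgraph (e, {e}) G" "nonseparable (e, {e})"
    using G e nonseparable_edge[of e] by (auto simp: subgraph_def simple_graph_def nonseparable_def)
  then show ?thesis
    using maximal_nonseparable_exists[OF G(1)] unfolding blocks_eq[OF G] by (fastforce simp: subgraph_def)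
qed

text \<open>The ends of a common edge are two common vertices, so the union is nonseparable and
  equals both graphs by maximality.\<close>

lemma blocks_edge_disjoint:
  assumes B: "maximal_nonseparable G B" "maximal_nonseparable G B'" and e: "e \<in> edges B" "e \<in> edges B'"
  shows "B = B'"
proof -
  have ns: "nonseparable B" "nonseparable B'" using B by (auto simp: maximal_nonseparable_def)
  then have s: "simple_graph B" "simple_graph B'" by (auto simp: nonseparable_def)
  have "card e \<le> card (verts B \<inter> verts B')" using s e by (intro card_mono) (auto simp: simple_graph_def)
  moreover have "card e = 2" using s e by (auto simp: simple_graph_def)
  ultimately have "nonseparable (join B B')" using ns by (intro nonseparable_join) auto
  moreover have "subgraph (join B B') G" using B by (intro subgraph_join) (auto simp: maximal_nonseparable_def)
  moreover have "subgraph B (join B B')" "subgraph B' (join B B')" using s by (auto simp: subgraph_def)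
  ultimately have "join B B' = B" "join B B' = B'" using B maximal_nonseparableD by blast+
  then show ?thesis by simp
qed

section \<open>Families of blocks in a connected graph\<close>

locale connected_simple_graph =
  fixes G :: "'v graph"
  assumes simple: "simple_graph G" and conn: "connected_graph G"
begin

lemma block_maximal: "B \<in> blocks G \<Longrightarrow> maximal_nonseparable G B"
  using blocks_eq[OF simple conn] by auto

lemma block_simps:
  assumes "B \<in> blocks G"
  shows "subgraph B G" "connected_graph B" "verts B \<noteq> {}" "finite (verts B)" "\<And>e. e \<in> edges B \<Longrightarrow> e \<subseteq> verts B"
  using block_maximal[OF assms] by (auto simp: maximal_nonseparable_def nonseparable_def simple_graph_def)

lemma finite_blocks: "finite (blocks G)"
proof (rule finite_subset)
  show "blocks G \<subseteq> Pow (verts G) \<times> Pow (Pow (verts G))"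
  proof
    fix B assume "B \<in> blocks G"
    then have "subgraph B G" by (rule block_simps(1))
    with simple show "B \<in> Pow (verts G) \<times> Pow (Pow (verts G))"
      by (auto simp: subgraph_def simple_graph_def mem_Times_iff)
  qed
  show "finite (Pow (verts G) \<times> Pow (Pow (verts G)))" using simple by (simp add: simple_graph_def)
qed

lemma subgraph_graph_Union:
  assumes "\<A> \<subseteq> blocks G"
  shows "subgraph (graph_Union \<A>) G"
proof -
  have s: "subgraph B G" if "B \<in> \<A>" for B using block_simps(1) assms that by blast
  have "verts (graph_Union \<A>) \<subseteq> verts G" "edges (graph_Union \<A>) \<subseteq> edges G"
    unfolding graph_Union_sel using s by (auto simp only: subgraph_def)
  moreover have "e \<subseteq> verts (graph_Union \<A>)" if "e \<in> edges (graph_Union \<A>)" for e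
  proof -
    obtain B where "B \<in> \<A>" "e \<in> edges B" using \<open>e \<in> edges (graph_Union \<A>)\<close> by auto
    then show ?thesis using block_simps(5)[of B e] assms by auto
  qed
  ultimately show ?thesis
    using simple finite_subset[of "verts (graph_Union \<A>)" "verts G"]
    unfolding subgraph_def simple_graph_def by blast
qed

text \<open>Distinct blocks share no edge, so the union of the family can serve as the ear. This is
  the tree-like structure behind the Euler count.\<close>

lemma block_meets_connected:
  assumes "\<A> \<subseteq> blocks G" "connected_graph (graph_Union \<A>)" "B \<in> blocks G" "B \<notin> \<A>"
  shows "card (verts B \<inter> verts (graph_Union \<A>)) \<le> 1"
proof (rule maximal_nonseparable_ear)
  show "maximal_nonseparable G B" using block_maximal assms by blast
  show "edges B \<inter> edges (graph_Union \<A>) = {}"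
  proof (rule ccontr)
    assume "edges B \<inter> edges (graph_Union \<A>) \<noteq> {}"
    then obtain e B' where "e \<in> edges B" "B' \<in> \<A>" "e \<in> edges B'" by auto
    then show False using blocks_edge_disjoint[of G B B' e] block_maximal assms by blast
  qed
qed (use assms subgraph_graph_Union in auto)

lemma graph_Union_insert: "graph_Union (insert B \<A>) = join B (graph_Union \<A>)"
  by (auto simp: prod_eq_iff)

lemma maximal_subset:
  assumes "finite A" and "\<And>T. Q T \<Longrightarrow> T \<subseteq> A" and "Q T"
  obtains S where "Q S" "\<And>T. Q T \<Longrightarrow> S \<subseteq> T \<Longrightarrow> T = S"
proof -
  have "finite {T. Q T}" by (rule finite_subset[of _ "Pow A"]) (use assms in auto)
  then show ?thesis using finite_has_maximal[of "{T. Q T}"] assms(3) that by (metis Collect_empty_eq mem_Collect_eq)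
qed

lemma connected_graph_insert:
  assumes "connected_graph (graph_Union \<A>)" "B \<in> blocks G" "verts B \<inter> verts (graph_Union \<A>) \<noteq> {}"
  shows "connected_graph (graph_Union (insert B \<A>))"
  unfolding graph_Union_insert using block_simps(2)[OF assms(2)] assms(1,3) by (rule connected_graph_join)

text \<open>Otherwise the vertex set of \<open>S\<close> would be edge-closed in the whole union,
  hence all of it, leaving no room for the vertices of the remaining blocks.\<close>

lemma connected_graph_extend:
  assumes "\<A> \<subseteq> blocks G" "connected_graph (graph_Union \<A>)" "S \<subset> \<A>" "S \<noteq> {}"
  shows "\<exists>B\<in>\<A> - S. verts B \<inter> verts (graph_Union S) \<noteq> {}"
proof (rule ccontr)
  assume "\<not> ?thesis"
  then have disj: "verts B \<inter> verts (graph_Union S) = {}" if "B \<in> \<A> - S" for B using that by blast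
  have "edge_closed (graph_Union \<A>) (verts (graph_Union S))"
  proof (rule edge_closedI)
    fix x y assume xy: "{x, y} \<in> edges (graph_Union \<A>)" "x \<in> verts (graph_Union S)"
    then obtain B where B: "B \<in> \<A>" "{x, y} \<in> edges B" by auto
    then have "x \<in> verts B" "y \<in> verts B" using block_simps(5)[of B "{x, y}"] assms(1) by auto
    then show "y \<in> verts (graph_Union S)" using disj[of B] B(1) xy(2) by auto
  qed
  moreover obtain B' where B': "B' \<in> S" using assms(4) by auto
  moreover have "verts B' \<noteq> {}" using B' assms block_simps(3) by blast
  then obtain x where "x \<in> verts B'" by auto
  ultimately have sub: "verts (graph_Union \<A>) \<subseteq> verts (graph_Union S)"
    using assms(3) connected_graphD[OF assms(2), of "verts (graph_Union S)" x] by fastforce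
  obtain B where B: "B \<in> \<A> - S" using assms(3) by auto
  moreover have "verts B \<noteq> {}" using B assms block_simps(3) by blast
  ultimately obtain y where y: "y \<in> verts B" by auto
  then have "y \<in> verts (graph_Union \<A>)" using B by auto
  then show False using sub y disj[OF B] by blast
qed

text \<open>An inclusion-maximal connected subfamily works: any further block meeting it could be
  added. This provides \<open>C_component\<close>.\<close>

lemma maximal_connected_subset:
  assumes "\<A> \<subseteq> blocks G" "\<A> \<noteq> {}"
  shows "\<exists>S. S \<subseteq> \<A> \<and> S \<noteq> {} \<and> connected_graph (graph_Union S) \<and>
    verts (graph_Union S) \<inter> verts (graph_Union (\<A> - S)) = {}"
proof -
  define Q where "Q = (\<lambda>S. S \<subseteq> \<A> \<and> S \<noteq> {} \<and> connected_graph (graph_Union S))"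
  obtain B where B: "B \<in> \<A>" using assms by auto
  have finA: "finite \<A>" using assms finite_blocks finite_subset by blast
  have "connected_graph B" using B assms block_simps(2) by blast
  then have QB: "Q {B}" using B by (simp add: Q_def)
  have sub: "T \<subseteq> \<A>" if "Q T" for T using that by (simp add: Q_def)
  obtain S where S: "Q S" "\<And>T. Q T \<Longrightarrow> S \<subseteq> T \<Longrightarrow> T = S"
    using maximal_subset[where Q = Q, OF finA sub QB] by blast
  have "verts B \<inter> verts (graph_Union S) = {}" if B: "B \<in> \<A> - S" for B
  proof (rule ccontr)
    assume "verts B \<inter> verts (graph_Union S) \<noteq> {}"
    moreover have "B \<in> blocks G" using B assms by blast
    ultimately have "Q (insert B S)" using connected_graph_insert[of S B] S(1) B by (simp add: Q_def)
    then show False using S(2)[of "insert B S"] B by blast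
  qed
  then have "verts (graph_Union S) \<inter> verts (graph_Union (\<A> - S)) = {}"
    unfolding graph_Union_sel by blast
  then show ?thesis using S(1) unfolding Q_def by blast
qed

text \<open>A single block satisfies the formula trivially. An inclusion-maximal connected subfamily
  satisfying it is the whole family, because otherwise a further block could be attached at exactly
  one vertex, preserving the formula.\<close>

lemma connected_euler:
  assumes A: "\<A> \<subseteq> blocks G" "connected_graph (graph_Union \<A>)" "\<A> \<noteq> {}"
  shows "real (card (\<Union>(verts ` \<A>))) + (\<Sum>B\<in>\<A>. 1 - real (card (verts B))) = 1"
proof -
  let ?e = "\<lambda>S. real (card (\<Union>(verts ` S))) + (\<Sum>B\<in>S. 1 - real (card (verts B)))"
  define Q where "Q = (\<lambda>S. S \<subseteq> \<A> \<and> S \<noteq> {} \<and> connected_graph (graph_Union S) \<and> ?e S = 1)"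
  obtain B where B: "B \<in> \<A>" using A by auto
  have finA: "finite \<A>" using A finite_blocks finite_subset by blast
  have "connected_graph B" using B A block_simps(2) by blast
  then have QB: "Q {B}" using B by (simp add: Q_def)
  have sub: "T \<subseteq> \<A>" if "Q T" for T using that by (simp add: Q_def)
  obtain S where S: "Q S" "\<And>T. Q T \<Longrightarrow> S \<subseteq> T \<Longrightarrow> T = S"
    using maximal_subset[where Q = Q, OF finA sub QB] by blast
  have S': "S \<subseteq> \<A>" "S \<noteq> {}" "connected_graph (graph_Union S)" "?e S = 1"
    using S(1) by (simp_all add: Q_def)
  have "S = \<A>"
  proof (rule ccontr)
    assume "S \<noteq> \<A>"
    with S'(1) have "S \<subset> \<A>" by blast
    then obtain B where B: "B \<in> \<A>" "B \<notin> S" "verts B \<inter> verts (graph_Union S) \<noteq> {}"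
      using connected_graph_extend[OF A(1,2) _ S'(2)] by blast
    let ?U = "\<Union>(verts ` S)"
    have Bb: "B \<in> blocks G" "S \<subseteq> blocks G" using B(1) S'(1) A(1) by blast+
    have "finite (verts B')" if "B' \<in> S" for B' using that Bb(2) block_simps(4) by blast
    moreover have finS: "finite S" using S'(1) finA by (rule finite_subset)
    ultimately have "finite ?U" by (intro finite_UN_I)
    with finS have fin: "finite S" "finite ?U" "finite (verts B)"
      using block_simps(4)[OF Bb(1)] by simp_all
    \<comment> \<open>At most one common vertex since \<open>S\<close> is connected, at least one by
      the choice of \<open>B\<close>; so \<open>B\<close> adds one vertex less than it has.\<close>
    have "card (verts B \<inter> ?U) \<le> 1" using block_meets_connected[OF Bb(2) S'(3) Bb(1) B(2)] by simp
    moreover have "card (verts B \<inter> ?U) \<noteq> 0" using B(3) fin by simp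
    ultimately have "card (verts B \<inter> ?U) = 1" by simp
    then have "card (verts B) + card ?U = card (\<Union>(verts ` insert B S)) + 1"
      using card_Un_Int[OF fin(3,2)] by simp
    then have e: "?e (insert B S) = 1" using B(2) fin(1) S'(4) by simp
    have "Q (insert B S)"
      unfolding Q_def using connected_graph_insert[OF S'(3) Bb(1) B(3)]
      by (intro conjI insert_subsetI insert_not_empty B(1) S'(1) e)
    then show False using S(2)[of "insert B S"] B(2) by blast
  qed
  then show ?thesis using S'(4) by simp
qed

text \<open>Every edge of \<open>G\<close> lies in a block, so a set that is edge-closed for the
  union is edge-closed for \<open>G\<close>.\<close>

lemma connected_all_blocks: "connected_graph (graph_Union (blocks G))"
proof (rule connected_graphI)
  fix K x y assume K: "edge_closed (graph_Union (blocks G)) K" "x \<in> K"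
    "x \<in> verts (graph_Union (blocks G))" "y \<in> verts (graph_Union (blocks G))"
  have "edges G \<subseteq> edges (graph_Union (blocks G))" using block_of_edge[OF simple conn] by auto
  then have "edge_closed G K" using K(1) edge_closed_mono by blast
  moreover have "verts (graph_Union (blocks G)) \<subseteq> verts G"
    using subgraph_graph_Union[of "blocks G"] by (simp add: subgraph_def)
  ultimately show "y \<in> K" using connected_graphD[OF conn] K by blast
qed

end

theorem theorem7p2:
  fixes G :: "'v::finite graph"
  assumes "simple_graph G" and "connected_graph G"
  shows "gorenstein (blocks G) 2 (CBP G)"
proof -
  interpret G: connected_simple_graph G using assms by unfold_locales
  define C where "C = {\<A>. \<A> \<subseteq> blocks G \<and> connected_graph (graph_Union \<A>)}"
  \<comment> \<open>The vertex sets of the blocks are the hyperedges; the axioms are supplied by the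
    facts on families of blocks.\<close>
  interpret hyperforest "blocks G" verts C
  proof
    show "\<A> \<subseteq> blocks G" if "\<A> \<in> C" for \<A> using that by (simp add: C_def)
    show "{} \<in> C" by (simp add: C_def connected_graph_def)
    show "{B} \<in> C" if "B \<in> blocks G" for B using that G.block_simps(2)[OF that] by (simp add: C_def)
    show "blocks G \<in> C" using G.connected_all_blocks by (simp add: C_def)
    show "real (card (\<Union>(verts ` \<A>))) + (\<Sum>B\<in>\<A>. 1 - real (card (verts B))) = 1"
      if "\<A> \<in> C" "\<A> \<noteq> {}" for \<A> using that G.connected_euler[of \<A>] by (simp add: C_def)
    show "\<exists>S\<in>C. S \<noteq> {} \<and> S \<subseteq> \<A> \<and> \<Union>(verts ` S) \<inter> \<Union>(verts ` (\<A> - S)) = {}"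
      if A: "\<A> \<subseteq> blocks G" "\<A> \<noteq> {}" for \<A>
    proof -
      obtain S where "S \<subseteq> \<A>" "S \<noteq> {}" "connected_graph (graph_Union S)"
        "verts (graph_Union S) \<inter> verts (graph_Union (\<A> - S)) = {}"
        using G.maximal_connected_subset[OF A] by blast
      then show ?thesis using A(1) by (intro bexI[of _ S]) (auto simp only: C_def graph_Union_sel)
    qed
  qed
  have "CBP G = P"
    unfolding CBP_def P_def by (simp add: C_def setcompr_eq_image)
  then show ?thesis using gorenstein_P by simp
qed

end
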